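(* There exists an absolute constant $c>0$ such that for every positive integer $n$ and every $\delta\in(0,1/2)$ the following holds. If $\mathcal{F}\subseteq 2^{[n]}$ is a set family of size $m\geq 2^{(1/2+\delta)n}$, then the number of (unordered) pairs $\{A,B\}\subseteq\mathcal{F}$ with $A\cap B=\varnothing$ is at most $m^{2-\frac{c\delta}{\log_2(1/\delta)}}$.
   Context: $2^{[n]}$ denotes the family of all subsets of $[n]=\{1,\dots,n\}$. A disjoint pair in $\mathcal{F}$ is a pair of sets $A,B\in\mathcal{F}$ with $A\cap B=\varnothing$. *)

theory Defs
  imports Complex_Main
begin

text \<open>The pair with members \<open>A\<close> and \<open>B\<close> is the set \<open>{A, B}\<close>. As \<open>A = B\<close> is
  not excluded, the pair \<open>{{}, {}} = {{}}\<close> is counted (once) when \<open>{} \<in> F\<close>; no other set is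
  disjoint from itself.\<close>

definition disjoint_pairs :: "'a set set \<Rightarrow> 'a set set set"
  where "disjoint_pairs F = {{A, B} | A B. A \<in> F \<and> B \<in> F \<and> A \<inter> B = {}}"

end

theory Submission
  imports Defs "HOL-Library.FuncSet"
begin

text \<open>
  Pick an ordered disjoint pair \<open>(A, B)\<close> uniformly among all \<open>N\<close> of them, and, given \<open>B\<close>, take
  \<open>t\<close> conditionally independent copies \<open>f 0, \<dots>, f (t - 1)\<close> of \<open>A\<close> with union \<open>U\<close>. As \<open>B\<close> lies
  in the complement of \<open>U\<close>, the entropy of \<open>(B, f)\<close> is at most \<open>t log m + n - E|U|\<close> (in bits). On
  the other hand \<open>E|U|\<close> is almost as large as the entropy of \<open>A\<close> given \<open>B\<close>: a coordinate that lies
  in \<open>A\<close> with conditional probability \<open>p\<close> is in \<open>U\<close> with probability \<open>1 - (1 - p)^t\<close>, and for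
  \<open>t\<close> of order \<open>log (1/\<delta>)\<close> this is at least the binary entropy of \<open>p\<close> minus \<open>\<delta>\<close>. The two bounds
  combine to \<open>(t + 1) log N \<le> 2 t log m + (1 + \<delta>) n\<close>, and \<open>n \<le> log m / (1/2 + \<delta>)\<close>.
\<close>

section \<open>Entropy\<close>

text \<open>This is \<open>ln z \<le> z - 1\<close> at \<open>z = r / q\<close>, scaled by
  \<open>q\<close>. With constant \<open>r\<close> it also bounds single entropy terms.\<close>

lemma mult_ln_diff_le:
  fixes q r :: real
  assumes "q \<ge> 0" "r > 0"
  shows "q * ln r - q * ln q \<le> r - q"
proof (cases "q = 0")
  case True
  then show ?thesis using assms by simp
next
  case False
  with assms have q: "q > 0" by simp
  have "q * ln (r / q) \<le> q * (r / q - 1)"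
    using q assms by (intro mult_left_mono ln_le_minus_one) auto
  then show ?thesis
    using q assms by (simp add: ln_div algebra_simps)
qed

text \<open>Nonnegativity of relative entropy. Neither function has to be normalised, so a
  comparison law \<open>r\<close> may be restricted to a set on which its mass is below 1.\<close>

lemma gibbs_inequality:
  fixes q r :: "'a \<Rightarrow> real"
  assumes "\<And>x. x \<in> S \<Longrightarrow> q x \<ge> 0" "\<And>x. x \<in> S \<Longrightarrow> r x > 0" "sum r S \<le> sum q S"
  shows "(\<Sum>x\<in>S. q x * ln (r x)) \<le> (\<Sum>x\<in>S. q x * ln (q x))"
proof -
  have "(\<Sum>x\<in>S. q x * ln (r x) - q x * ln (q x)) \<le> (\<Sum>x\<in>S. r x - q x)"
    using assms by (intro sum_mono mult_ln_diff_le) auto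
  then show ?thesis
    using assms(3) by (simp add: sum_subtractf)
qed

text \<open>In nats. Since \<open>ln 0 = 0\<close> in HOL, the value at the endpoints \<open>0\<close> and \<open>1\<close> is the correct one, \<open>0\<close>.\<close>

definition bin_entropy :: "real \<Rightarrow> real"
  where "bin_entropy p = - (p * ln p) - (1 - p) * ln (1 - p)"

section \<open>Upper bounds on binary entropy\<close>

lemma bin_entropy_le_ln2:
  assumes "0 \<le> p" "p \<le> 1"
  shows "bin_entropy p \<le> ln 2"
  using mult_ln_diff_le[of p "1/2"] mult_ln_diff_le[of "1 - p" "1/2"] assms
  by (simp add: bin_entropy_def ln_div algebra_simps)

lemma bin_entropy_le_ln:
  assumes "p \<le> 1"
  shows "bin_entropy p \<le> p - p * ln p"
  using mult_ln_diff_le[of "1 - p" 1] assms by (simp add: bin_entropy_def)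

text \<open>The bound \<open>- ln u \<le> 1 / u - 1\<close> is taken at \<open>u = sqrt p\<close>
  instead of \<open>p\<close>, so that the result tends to 0 with \<open>p\<close>.\<close>

lemma bin_entropy_le_sqrt:
  assumes "0 \<le> p" "p \<le> 1"
  shows "bin_entropy p \<le> 2 * sqrt p"
proof -
  define u where "u = sqrt p"
  have u: "u \<ge> 0" "p = u * u" using assms by (simp_all add: u_def)
  have "u * (- (u * ln u)) \<le> u * (1 - u)"
    using mult_ln_diff_le[of u 1] u by (intro mult_left_mono) auto
  then have "- (u * (u * ln u)) \<le> u - p"
    by (simp add: u(2) algebra_simps)
  moreover have "p * ln p = 2 * (u * (u * ln u))"
    using u by (cases "u = 0") (auto simp: ln_mult)
  ultimately show ?thesis
    using bin_entropy_le_ln[OF assms(2)] assms(1) unfolding u_def[symmetric] by linarith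
qed

lemma half_le_ln2: "1 / 2 \<le> ln (2::real)"
proof -
  have "ln (exp 1) \<le> ln (4::real)"
    using exp_le by (subst ln_le_cancel_iff) auto
  moreover have "ln (4::real) = 2 * ln 2"
    using ln_realpow[of 2 2] by simp
  ultimately show ?thesis by simp
qed

lemma one_minus_power_le:
  fixes p :: real
  assumes "0 \<le> p" "p \<le> 1"
  shows "(1 - p) ^ t \<le> exp (- (real t * p))"
proof -
  have "(1 - p) ^ t \<le> exp (- p) ^ t"
    using assms exp_ge_add_one_self[of "- p"] by (intro power_mono) auto
  then show ?thesis by (simp add: exp_of_nat_mult[symmetric])
qed

text \<open>For small \<open>p\<close> the hit probability behaves like \<open>t * p\<close> and the
  entropy like \<open>p * ln (1 / p)\<close>. The slack \<open>\<delta>\<close> pays for the tiny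
  \<open>p\<close> at which \<open>ln (1 / p)\<close> outgrows \<open>t\<close>.\<close>

lemma bin_entropy_le_hit:
  fixes p \<delta> :: real
  assumes p: "0 \<le> p" "p \<le> 1" and \<delta>: "0 < \<delta>" "\<delta> < 1/2"
    and t: "real t \<ge> 64 * log 2 (1 / \<delta>)"
  shows "bin_entropy p \<le> ln 2 * (1 - (1 - p) ^ t + \<delta>)"
proof -
  define s where "s = log 2 (1 / \<delta>)"
  have "2 \<le> 1 / \<delta>" using \<delta> by (simp add: field_simps)
  then have "log 2 2 \<le> s" unfolding s_def using \<delta> by (subst log_le_cancel_iff) auto
  then have s1: "s \<ge> 1" by simp
  have \<delta>s: "ln \<delta> = - (s * ln 2)"
    using \<delta> by (simp add: s_def log_def ln_div)
  have hit: "(1 - p) ^ t \<le> 1" using p by (intro power_le_one) auto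
  note expt = one_minus_power_le[OF p, of t]
  \<comment> \<open>Entropy at most 1 bit, entropy at most \<open>\<delta>\<close> bits, and the range in which \<open>ln (1/p)\<close> is
    \<open>O(s)\<close>, hence dominated by \<open>t\<close>.\<close>
  consider "p \<ge> 1/64" | "p < 1/64" "4 * sqrt p \<le> \<delta>" | "p < 1/64" "4 * sqrt p > \<delta>"
    by linarith
  then show ?thesis
  proof cases
    case 1
    \<comment> \<open>The factor 64 in \<open>t\<close> cancels the threshold
      \<open>1/64\<close>.\<close>
    have "real t * (1/64) \<le> real t * p" using 1 by (intro mult_left_mono) auto
    then have "s \<le> real t * p" using t by (simp add: s_def)
    moreover have "s * ln 2 \<le> s * 1" using s1 ln_2_less_1 by (intro mult_left_mono) auto
    ultimately have "exp (- (real t * p)) \<le> exp (ln \<delta>)" unfolding \<delta>s exp_le_cancel_iff by simp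
    then have "(1 - p) ^ t \<le> \<delta>" using expt \<delta> by simp
    then have "ln 2 * 1 \<le> ln 2 * (1 - (1 - p) ^ t + \<delta>)" by (intro mult_left_mono) auto
    then show ?thesis using bin_entropy_le_ln2[OF p] by linarith
  next
    case 2
    have "2 * sqrt p \<le> \<delta> / 2" using 2 by simp
    also have "\<dots> \<le> ln 2 * \<delta>" using half_le_ln2 \<delta> mult_right_mono[of "1/2" "ln 2" \<delta>] by simp
    also have "\<dots> \<le> ln 2 * (1 - (1 - p) ^ t + \<delta>)" using hit by (intro mult_left_mono) auto
    finally show ?thesis using bin_entropy_le_sqrt[OF p] by simp
  next
    case 3
    define y where "y = real t * p"
    have p0: "p > 0" using 3 \<delta> p by (cases "p = 0") auto
    have y0: "y \<ge> 0" using p by (simp add: y_def)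
    have "exp (- y) \<le> 1 / (1 + y)"
      using exp_ge_add_one_self[of y] y0 by (simp add: exp_minus field_simps)
    then have miss: "1 - (1 - p) ^ t \<ge> 1 - 1 / (1 + y)" using expt by (simp add: y_def)
    \<comment> \<open>The right-hand factor is at least \<open>1 / 2\<close> for
      \<open>y \<ge> 1\<close> and at least \<open>y / 2\<close> for
      \<open>y \<le> 1\<close>.\<close>
    have main: "bin_entropy p \<le> ln 2 * (1 - 1 / (1 + y))"
    proof (cases "y \<ge> 1")
      case True
      \<comment> \<open>The threshold \<open>1/64\<close> is small enough to keep the entropy below
        half a bit.\<close>
      have "sqrt p \<le> 1/8" using 3 by (intro real_le_lsqrt) (auto simp: power2_eq_square)
      then have "bin_entropy p \<le> 1/4" using bin_entropy_le_sqrt[OF p] by simp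
      also have "\<dots> \<le> ln 2 * (1/2)" using half_le_ln2 by simp
      also have "\<dots> \<le> ln 2 * (1 - 1 / (1 + y))"
        using True by (intro mult_left_mono) (auto simp: field_simps)
      finally show ?thesis .
    next
      case False
      have "ln \<delta> \<le> ln (4 * sqrt p)" using 3 \<delta> p0 by (subst ln_le_cancel_iff) auto
      also have "\<dots> = ln 4 + ln p / 2" using p0 by (simp add: ln_mult ln_sqrt)
      finally have "- ln p \<le> 4 * ln 2 + 2 * s * ln 2"
        using \<delta>s ln_realpow[of 2 2] by simp
      \<comment> \<open>The 1 is absorbed by \<open>1 \<le> 2 * ln 2\<close>; as
        \<open>s \<ge> 1\<close>, the factor is at most \<open>8 * s\<close>, well below
        \<open>t / 2\<close>.\<close>
      then have "1 - ln p \<le> ln 2 * (6 + 2 * s)" using half_le_ln2 by (simp add: algebra_simps)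
      also have "\<dots> \<le> ln 2 * (real t / 2)" using s1 t by (intro mult_left_mono) (auto simp: s_def)
      finally have "p * (1 - ln p) \<le> p * (ln 2 * (real t / 2))" using p by (intro mult_left_mono) auto
      also have "\<dots> = ln 2 * (y / 2)" by (simp add: y_def)
      also have "\<dots> \<le> ln 2 * (1 - 1 / (1 + y))"
      proof (intro mult_left_mono)
        have "y * y \<le> 1 * y" using False y0 by (intro mult_right_mono) auto
        then show "y / 2 \<le> 1 - 1 / (1 + y)" using y0 by (simp add: field_simps)
      qed auto
      finally show ?thesis using bin_entropy_le_ln[OF p(2)] by (simp add: algebra_simps)
    qed
    also have "\<dots> \<le> ln 2 * (1 - (1 - p) ^ t + \<delta>)"
      using miss \<delta> by (intro mult_left_mono) auto
    finally show ?thesis .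
  qed
qed

section \<open>Entropy of a random member of a set family\<close>

lemma card_not_mem:
  assumes "finite G"
  shows "real (card {A \<in> G. x \<notin> A}) = real (card G) - real (card {A \<in> G. x \<in> A})"
proof -
  have "{A \<in> G. x \<notin> A} = G - {A \<in> G. x \<in> A}" by auto
  moreover have "card {A \<in> G. x \<in> A} \<le> card G" using assms by (intro card_mono) auto
  ultimately show ?thesis using assms by (simp add: card_Diff_subset of_nat_diff)
qed

text \<open>Subadditivity of entropy: the uniform law on \<open>G\<close> is compared, by Gibbs,
  with the product \<open>r\<close> of its coordinate marginals.\<close>

lemma ln_card_le_sum_bin_entropy:
  fixes G :: "'a set set"
  assumes X: "finite X" and G: "G \<subseteq> Pow X" "G \<noteq> {}"
  shows "ln (card G) \<le> (\<Sum>x\<in>X. bin_entropy (card {A \<in> G. x \<in> A} / card G))"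
proof -
  define p where "p x = card {A \<in> G. x \<in> A} / card G" for x
  define w where "w A x = (if x \<in> A then p x else 1 - p x)" for A x
  define r where "r A = (\<Prod>x\<in>X. w A x)" for A
  have fG: "finite G" using X G by (meson finite_Pow_iff finite_subset)
  then have g: "card G > 0" using G by (simp add: card_gt_0_iff)
  have compl: "1 - p x = card {A \<in> G. x \<notin> A} / card G" for x
    using g card_not_mem[OF fG, of x] by (simp add: p_def field_simps)
  have p01: "0 \<le> p x" "0 \<le> 1 - p x" for x
    unfolding compl by (simp_all add: p_def)
  \<comment> \<open>A marginal may be 0 or 1, but a factor met by a member of \<open>G\<close> is
    positive, since that member is itself counted in it.\<close>
  have wpos: "w A x > 0" if "A \<in> G" for A x
  proof (cases "x \<in> A")
    case True
    then have "card {A \<in> G. x \<in> A} > 0" using that fG by (auto simp: card_gt_0_iff)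
    then show ?thesis using True g by (simp add: w_def p_def)
  next
    case False
    then have "card {A \<in> G. x \<notin> A} > 0" using that fG by (auto simp: card_gt_0_iff)
    then show ?thesis using False g by (simp add: w_def compl)
  qed
  have "sum r (Pow X) = (\<Sum>A\<in>Pow X. (\<Prod>x\<in>A. p x) * (\<Prod>x\<in>X - A. 1 - p x))"
  proof (intro sum.cong refl)
    fix A assume A: "A \<in> Pow X"
    then have "r A = (\<Prod>x\<in>X - A. w A x) * (\<Prod>x\<in>A. w A x)"
      unfolding r_def using X by (intro prod.subset_diff) auto
    then show "r A = (\<Prod>x\<in>A. p x) * (\<Prod>x\<in>X - A. 1 - p x)"
      by (simp add: w_def)
  qed
  also have "\<dots> = (\<Prod>x\<in>X. p x + (1 - p x))" using X by (rule prod_add[symmetric])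
  finally have "sum r (Pow X) = 1" by simp
  moreover have "sum r G \<le> sum r (Pow X)"
    using X G p01 by (intro sum_mono2) (simp_all add: r_def w_def prod_nonneg)
  ultimately have "sum r G \<le> 1" by simp
  then have "(\<Sum>A\<in>G. 1 / card G * ln (r A)) \<le> (\<Sum>A\<in>G. 1 / card G * ln (1 / card G))"
    using g wpos by (intro gibbs_inequality) (auto simp: r_def intro!: prod_pos)
  then have "(\<Sum>A\<in>G. ln (r A)) / card G \<le> - ln (card G)"
    using g by (simp add: ln_div sum_divide_distrib[symmetric])
  moreover have "(\<Sum>A\<in>G. ln (r A)) = (\<Sum>x\<in>X. \<Sum>A\<in>G. ln (w A x))"
    using X unfolding r_def
    by (subst sum.swap) (intro sum.cong refl ln_prod less_imp_neq[OF wpos, symmetric])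
  moreover have "(\<Sum>A\<in>G. ln (w A x)) / card G = - bin_entropy (p x)" for x
  proof -
    have "(\<Sum>A\<in>G. ln (w A x)) = (\<Sum>A\<in>G. if x \<in> A then ln (p x) else ln (1 - p x))"
      by (intro sum.cong) (auto simp: w_def)
    also have "\<dots> = card {A \<in> G. x \<in> A} * ln (p x) + card {A \<in> G. x \<notin> A} * ln (1 - p x)"
      using fG by (simp add: sum.If_cases Int_def)
    finally have "(\<Sum>A\<in>G. ln (w A x)) / card G = p x * ln (p x) + (1 - p x) * ln (1 - p x)"
      unfolding compl by (simp add: p_def add_divide_distrib)
    then show ?thesis by (simp add: bin_entropy_def)
  qed
  ultimately show ?thesis
    by (simp add: sum_divide_distrib sum_negf p_def)
qed

section \<open>Disjoint pairs\<close>

definition disj_nbrs :: "'a set set \<Rightarrow> 'a set \<Rightarrow> 'a set set"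
  where "disj_nbrs F B = {A \<in> F. A \<inter> B = {}}"

text \<open>Ordered pairs map onto unordered ones. The ordered count is the one whose logarithm is
  the entropy of a random pair \<open>(A, B)\<close>.\<close>

lemma card_disjoint_pairs_le:
  assumes "finite F"
  shows "card (disjoint_pairs F) \<le> (\<Sum>B\<in>F. card (disj_nbrs F B))"
proof -
  have "disjoint_pairs F = (\<lambda>(B, A). {A, B}) ` (SIGMA B:F. disj_nbrs F B)"
    by (force simp: disjoint_pairs_def disj_nbrs_def)
  moreover have fin: "finite (disj_nbrs F B)" for B using assms by (simp add: disj_nbrs_def)
  ultimately have "card (disjoint_pairs F) \<le> card (SIGMA B:F. disj_nbrs F B)"
    using assms by (simp only: card_image_le finite_SigmaI)
  also have "\<dots> = (\<Sum>B\<in>F. card (disj_nbrs F B))"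
    using assms fin by simp
  finally show ?thesis .
qed

text \<open>Linearity of expectation, scaled by the number of tuples: a point lies outside the union
  iff all \<open>t\<close> independent choices miss it.\<close>

lemma sum_card_diff_Union_PiE:
  fixes G :: "'a set set"
  assumes X: "finite X" and G: "finite G" "G \<noteq> {}"
  shows "(\<Sum>f\<in>{..<t} \<rightarrow>\<^sub>E G. real (card (X - (\<Union>i<t. f i)))) =
    real (card G) ^ t * (\<Sum>x\<in>X. (1 - card {A \<in> G. x \<in> A} / card G) ^ t)"
proof -
  have fin: "finite ({..<t} \<rightarrow>\<^sub>E G)" using G by (intro finite_PiE) auto
  have g: "real (card G) > 0" using G by (simp add: card_gt_0_iff)
  have "(\<Sum>f\<in>{..<t} \<rightarrow>\<^sub>E G. real (card (X - (\<Union>i<t. f i)))) =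
      (\<Sum>f\<in>{..<t} \<rightarrow>\<^sub>E G. \<Sum>x\<in>X. if x \<in> (\<Union>i<t. f i) then 0 else 1)"
    using X by (intro sum.cong refl) (simp add: sum.If_cases set_diff_eq Int_def)
  also have "\<dots> = (\<Sum>x\<in>X. \<Sum>f\<in>{..<t} \<rightarrow>\<^sub>E G. if x \<in> (\<Union>i<t. f i) then 0 else 1)"
    by (rule sum.swap)
  also have "\<dots> = (\<Sum>x\<in>X. real (card G) ^ t * (1 - card {A \<in> G. x \<in> A} / card G) ^ t)"
  proof (intro sum.cong refl)
    fix x
    have "{f \<in> {..<t} \<rightarrow>\<^sub>E G. x \<notin> (\<Union>i<t. f i)} = {..<t} \<rightarrow>\<^sub>E {A \<in> G. x \<notin> A}"
      unfolding PiE_iff set_eq_iff by (simp add: conj_ac) blast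
    then have "(\<Sum>f\<in>{..<t} \<rightarrow>\<^sub>E G. if x \<in> (\<Union>i<t. f i) then 0 else 1) =
        real (card ({..<t} \<rightarrow>\<^sub>E {A \<in> G. x \<notin> A}))"
      using fin by (simp add: sum.If_cases Int_def)
    also have "\<dots> = real (card {A \<in> G. x \<notin> A}) ^ t"
      by (simp add: card_funcsetE)
    also have "real (card {A \<in> G. x \<notin> A}) = card G * (1 - card {A \<in> G. x \<in> A} / card G)"
      using g card_not_mem[OF G(1), of x] by (simp add: right_diff_distrib)
    finally show "(\<Sum>f\<in>{..<t} \<rightarrow>\<^sub>E G. if x \<in> (\<Union>i<t. f i) then 0 else 1) =
        real (card G) ^ t * (1 - card {A \<in> G. x \<in> A} / card G) ^ t"
      by (simp add: power_mult_distrib)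
  qed
  finally show ?thesis by (simp add: sum_distrib_left)
qed

text \<open>With \<open>f\<close> fixed first, the sets \<open>B\<close> disjoint from every
  \<open>f i\<close> are subsets of the complement of the union, so the power of 2 in the
  denominator bounds their number.\<close>

lemma sum_weight_le_one:
  fixes F :: "'a set set"
  assumes X: "finite X" and F: "F \<subseteq> Pow X" "F \<noteq> {}" and D: "D \<subseteq> F"
  shows "(\<Sum>B\<in>D. \<Sum>f\<in>{..<t} \<rightarrow>\<^sub>E disj_nbrs F B.
      1 / (real (card F) ^ t * 2 ^ card (X - (\<Union>i<t. f i)))) \<le> 1"
proof -
  define w where "w f = 1 / (real (card F) ^ t * 2 ^ card (X - (\<Union>i<t. f i)))"
    for f :: "nat \<Rightarrow> 'a set"
  have fF: "finite F" using X F by (meson finite_Pow_iff finite_subset)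
  then have fD: "finite D" and m: "card F > 0"
    using D F by (auto intro: finite_subset simp: card_gt_0_iff)
  have fin: "finite ({..<t} \<rightarrow>\<^sub>E F)" using fF by (intro finite_PiE) auto
  have "{..<t} \<rightarrow>\<^sub>E disj_nbrs F B =
      {f \<in> {..<t} \<rightarrow>\<^sub>E F. \<forall>i<t. f i \<inter> B = {}}" for B
    unfolding PiE_iff set_eq_iff disj_nbrs_def by simp blast
  then have "(\<Sum>B\<in>D. \<Sum>f\<in>{..<t} \<rightarrow>\<^sub>E disj_nbrs F B. w f) =
      (\<Sum>B\<in>D. \<Sum>f | f \<in> {..<t} \<rightarrow>\<^sub>E F \<and> (\<forall>i<t. f i \<inter> B = {}). w f)"
    by simp
  also have "\<dots> = (\<Sum>f\<in>{..<t} \<rightarrow>\<^sub>E F. \<Sum>B | B \<in> D \<and> (\<forall>i<t. f i \<inter> B = {}). w f)"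
    by (rule sum.swap_restrict[OF fD fin])
  also have "\<dots> \<le> (\<Sum>f\<in>{..<t} \<rightarrow>\<^sub>E F. 1 / real (card F) ^ t)"
  proof (rule sum_mono)
    fix f :: "nat \<Rightarrow> 'a set"
    have "{B. B \<in> D \<and> (\<forall>i<t. f i \<inter> B = {})} \<subseteq> Pow (X - (\<Union>i<t. f i))"
      using D F by auto
    then have "card {B. B \<in> D \<and> (\<forall>i<t. f i \<inter> B = {})} \<le> card (Pow (X - (\<Union>i<t. f i)))"
      using X by (intro card_mono) auto
    also have "\<dots> = 2 ^ card (X - (\<Union>i<t. f i))" using X by (simp add: card_Pow)
    finally have "real (card {B. B \<in> D \<and> (\<forall>i<t. f i \<inter> B = {})}) \<le> 2 ^ card (X - (\<Union>i<t. f i))"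
      by (simp flip: of_nat_le_iff)
    then have "real (card {B. B \<in> D \<and> (\<forall>i<t. f i \<inter> B = {})}) * w f
        \<le> 2 ^ card (X - (\<Union>i<t. f i)) * w f"
      by (intro mult_right_mono) (auto simp: w_def)
    then show "(\<Sum>B | B \<in> D \<and> (\<forall>i<t. f i \<inter> B = {}). w f) \<le> 1 / real (card F) ^ t"
      by (simp add: w_def)
  qed
  also have "\<dots> = 1" using m by (simp add: card_funcsetE)
  finally show ?thesis by (simp add: w_def)
qed

lemma ln_sum_disj_nbrs_le:
  fixes F :: "'a set set"
  assumes X: "finite X" and F: "F \<subseteq> Pow X" and \<delta>: "0 < \<delta>" "\<delta> < 1/2"
    and t: "real t \<ge> 64 * log 2 (1 / \<delta>)"
    and N: "N = (\<Sum>B\<in>F. real (card (disj_nbrs F B)))" "N > 0"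
  shows "(t + 1) * ln N \<le> 2 * t * ln (card F) + ln 2 * (1 + \<delta>) * card X"
proof -
  define d where "d B = real (card (disj_nbrs F B))" for B
  \<comment> \<open>Only these \<open>B\<close> have positive probability; elsewhere
    \<open>d B\<close> is 0 and cannot be divided by.\<close>
  define D where "D = {B \<in> F. disj_nbrs F B \<noteq> {}}"
  define p where "p B = d B / N" for B
  define m where "m = real (card F)"
  \<comment> \<open>\<open>E\<close> is the entropy of \<open>A\<close> given \<open>B\<close>;
    \<open>M B\<close> below is the expected number of points outside the union, given
    \<open>B\<close>.\<close>
  define E where "E = (\<Sum>B\<in>D. p B * ln (d B))"
  define M where "M B = (\<Sum>x\<in>X. (1 - card {A \<in> disj_nbrs F B. x \<in> A} / d B) ^ t)" for B
  define k where "k f = card (X - (\<Union>i<t. f i))" for f :: "nat \<Rightarrow> 'a set"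
  define T where "T B = {..<t} \<rightarrow>\<^sub>E disj_nbrs F B" for B
  have fF: "finite F" using X F by (meson finite_Pow_iff finite_subset)
  have fN: "finite (disj_nbrs F B)" for B using fF by (simp add: disj_nbrs_def)
  have fD: "finite D" using fF by (simp add: D_def)
  have F0: "F \<noteq> {}" using N by auto
  have m: "m > 0" using F0 fF by (simp add: m_def card_gt_0_iff)
  have d: "d B > 0" if "B \<in> D" for B
    using that fN by (simp add: d_def D_def card_gt_0_iff)
  then have p: "p B > 0" if "B \<in> D" for B
    using that N by (simp add: p_def)
  have "N = sum d D"
    unfolding N(1) d_def using fF by (intro sum.mono_neutral_right) (auto simp: D_def)
  then have sum_p: "sum p D = 1" using N(2) by (simp add: p_def flip: sum_divide_distrib)
  have ln_p: "ln (p B) = ln (d B) - ln N" if "B \<in> D" for B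
    using d[OF that] N(2) by (simp add: p_def ln_div)

  \<comment> \<open>The entropy of \<open>B\<close>, which is \<open>ln N - E\<close>, is at most
    \<open>ln m\<close>.\<close>
  have "(\<Sum>B\<in>D. p B * ln (1 / m)) \<le> (\<Sum>B\<in>D. p B * ln (p B))"
  proof (rule gibbs_inequality)
    have "card D \<le> card F" using fF by (intro card_mono) (auto simp: D_def)
    then show "(\<Sum>B\<in>D. 1 / m) \<le> sum p D" using m unfolding sum_p by (simp add: m_def)
  qed (use p m in \<open>auto intro: less_imp_le\<close>)
  also have "\<dots> = (\<Sum>B\<in>D. p B * ln (d B) - p B * ln N)"
    by (intro sum.cong refl) (simp add: ln_p algebra_simps)
  also have "\<dots> = E - ln N"
    by (simp add: E_def sum_subtractf sum_p flip: sum_distrib_right)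
  finally have jensen: "ln N - ln m \<le> E"
    using m by (simp add: sum_p sum_negf ln_div flip: sum_distrib_right)

  have fT: "finite (T B)" for B unfolding T_def using fN by (intro finite_PiE) auto
  have cardT: "real (card (T B)) = d B ^ t" for B
    by (simp add: T_def d_def card_funcsetE)
  \<comment> \<open>\<open>?q\<close> is the law of \<open>(B, f)\<close>; under \<open>?r\<close> the \<open>f i\<close> are independent and uniform on \<open>F\<close>, and
    \<open>B\<close> is then uniform among the subsets of the complement of their union.\<close>
  let ?q = "\<lambda>(B, f). p B / d B ^ t"
  let ?r = "\<lambda>(B, f :: nat \<Rightarrow> 'a set). 1 / (m ^ t * 2 ^ k f)"
  have "(\<Sum>z\<in>Sigma D T. ?q z * ln (?r z)) \<le> (\<Sum>z\<in>Sigma D T. ?q z * ln (?q z))"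
  proof (rule gibbs_inequality)
    have "sum ?q (Sigma D T) = (\<Sum>B\<in>D. \<Sum>f\<in>T B. p B / d B ^ t)"
      using fD fT by (subst sum.Sigma) auto
    also have "\<dots> = sum p D" using d by (intro sum.cong refl) (fastforce simp: cardT)
    finally have "sum ?q (Sigma D T) = 1" by (simp add: sum_p)
    moreover have "sum ?r (Sigma D T) = (\<Sum>B\<in>D. \<Sum>f\<in>T B. 1 / (m ^ t * 2 ^ k f))"
      using fD fT by (subst sum.Sigma) auto
    moreover have "\<dots> \<le> 1"
      unfolding T_def m_def k_def using X F F0 by (rule sum_weight_le_one) (auto simp: D_def)
    ultimately show "sum ?r (Sigma D T) \<le> sum ?q (Sigma D T)" by simp
  qed (use p d m in \<open>auto intro!: divide_nonneg_nonneg less_imp_le\<close>)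
  moreover have "(\<Sum>z\<in>Sigma D T. ?q z * ln (?r z)) =
      (\<Sum>B\<in>D. \<Sum>f\<in>T B. p B / d B ^ t * ln (1 / (m ^ t * 2 ^ k f)))"
    using fD fT by (subst sum.Sigma) (auto simp: case_prod_beta)
  moreover have "\<dots> = (\<Sum>B\<in>D. - (p B * (t * ln m)) - ln 2 * (p B * M B))"
  proof (intro sum.cong refl)
    fix B assume B: "B \<in> D"
    have "(\<Sum>f\<in>T B. p B / d B ^ t * ln (1 / (m ^ t * 2 ^ k f))) =
        (\<Sum>f\<in>T B. - (p B / d B ^ t * (t * ln m)) - ln 2 * p B / d B ^ t * k f)"
      using m by (intro sum.cong refl) (simp add: ln_div ln_mult ln_realpow algebra_simps)
    also have "\<dots> = - (d B ^ t * (p B / d B ^ t * (t * ln m))) - ln 2 * p B / d B ^ t * (\<Sum>f\<in>T B. real (k f))"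
      by (simp only: sum_subtractf sum_constant cardT sum_distrib_left[symmetric])
    also have "(\<Sum>f\<in>T B. real (k f)) = d B ^ t * M B"
      unfolding T_def k_def d_def M_def
      using X fN B by (intro sum_card_diff_Union_PiE) (auto simp: D_def)
    finally show "(\<Sum>f\<in>T B. p B / d B ^ t * ln (1 / (m ^ t * 2 ^ k f))) =
        - (p B * (t * ln m)) - ln 2 * (p B * M B)"
      using d[OF B] by simp
  qed
  moreover have "\<dots> = - (t * ln m) - ln 2 * (\<Sum>B\<in>D. p B * M B)"
    by (simp add: sum_subtractf sum_negf sum_p flip: sum_distrib_left sum_distrib_right)
  moreover have "(\<Sum>z\<in>Sigma D T. ?q z * ln (?q z)) =
      (\<Sum>B\<in>D. \<Sum>f\<in>T B. p B / d B ^ t * ln (p B / d B ^ t))"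
    using fD fT by (subst sum.Sigma) (auto simp: case_prod_beta)
  moreover have "\<dots> = (\<Sum>B\<in>D. (1 - real t) * (p B * ln (d B)) - p B * ln N)"
  proof (intro sum.cong refl)
    fix B assume B: "B \<in> D"
    then show "(\<Sum>f\<in>T B. p B / d B ^ t * ln (p B / d B ^ t)) =
        (1 - real t) * (p B * ln (d B)) - p B * ln N"
      using d[OF B] p[OF B] by (simp add: cardT ln_div ln_realpow ln_p algebra_simps)
  qed
  moreover have "\<dots> = (1 - real t) * E - ln N"
    by (simp add: E_def sum_subtractf sum_p flip: sum_distrib_left sum_distrib_right)
  \<comment> \<open>The left side is the entropy of \<open>(B, f)\<close>: \<open>ln N - E\<close>
    from \<open>B\<close> and \<open>E\<close> from each of the \<open>t\<close> copies.\<close>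
  ultimately have upper: "ln N + (real t - 1) * E \<le> t * ln m + ln 2 * (\<Sum>B\<in>D. p B * M B)"
    by (simp add: algebra_simps)

  \<comment> \<open>Summing the coordinatewise comparison shows that, given \<open>B\<close>, a
    union missing many points forces few choices for \<open>A\<close>.\<close>
  have "ln 2 * M B \<le> ln 2 * ((1 + \<delta>) * card X) - ln (d B)" if B: "B \<in> D" for B
  proof -
    define a where "a x = card {A \<in> disj_nbrs F B. x \<in> A} / d B" for x
    have "ln (d B) \<le> (\<Sum>x\<in>X. bin_entropy (a x))"
      unfolding a_def d_def using X F B
      by (intro ln_card_le_sum_bin_entropy) (auto simp: D_def disj_nbrs_def)
    also have "\<dots> \<le> (\<Sum>x\<in>X. ln 2 * (1 - (1 - a x) ^ t + \<delta>))"
    proof (intro sum_mono bin_entropy_le_hit \<delta> t)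
      fix x
      have "card {A \<in> disj_nbrs F B. x \<in> A} \<le> card (disj_nbrs F B)"
        using fN by (intro card_mono) auto
      then show "0 \<le> a x" "a x \<le> 1" using d[OF B] by (auto simp: a_def d_def)
    qed
    also have "\<dots> = ln 2 * ((1 + \<delta>) * card X - M B)"
      by (simp add: M_def a_def sum.distrib sum_subtractf algebra_simps flip: sum_distrib_left)
    finally show ?thesis by (simp add: algebra_simps)
  qed
  then have "(\<Sum>B\<in>D. p B * (ln 2 * M B)) \<le> (\<Sum>B\<in>D. p B * (ln 2 * ((1 + \<delta>) * card X) - ln (d B)))"
    using p by (intro sum_mono mult_left_mono) (auto intro: less_imp_le)
  also have "\<dots> = ln 2 * ((1 + \<delta>) * card X) - E"
    by (simp only: right_diff_distrib sum_subtractf E_def sum_p mult_1 flip: sum_distrib_right)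
  also have "(\<Sum>B\<in>D. p B * (ln 2 * M B)) = ln 2 * (\<Sum>B\<in>D. p B * M B)"
    by (simp add: sum_distrib_left mult_ac)
  finally have "ln N + t * E \<le> t * ln m + ln 2 * ((1 + \<delta>) * card X)"
    using upper by (simp add: algebra_simps)
  \<comment> \<open>Eliminating \<open>E\<close> raises the coefficient of \<open>ln N\<close> to
    \<open>t + 1\<close>.\<close>
  moreover have "t * (ln N - ln m) \<le> t * E"
    using jensen by (intro mult_left_mono) auto
  ultimately show ?thesis by (simp add: m_def algebra_simps)
qed

section \<open>Choice of \<open>t\<close> and the resulting exponent\<close>

lemma card_disjoint_pairs_le_powr:
  fixes F :: "'a set set"
  assumes X: "finite X" and F: "F \<subseteq> Pow X" and \<delta>: "0 < \<delta>" "\<delta> < 1/2"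
    and m: "real (card F) \<ge> 2 powr ((1/2 + \<delta>) * real (card X))"
  shows "real (card (disjoint_pairs F)) \<le> real (card F) powr (2 - 1/66 * \<delta> / log 2 (1/\<delta>))"
proof -
  define s where "s = log 2 (1 / \<delta>)"
  define t where "t = nat \<lceil>64 * s\<rceil>"
  define N where "N = (\<Sum>B\<in>F. real (card (disj_nbrs F B)))"
  have fF: "finite F" using X F by (meson finite_Pow_iff finite_subset)
  have "2 powr ((1/2 + \<delta>) * real (card X)) \<ge> 1" using \<delta> by (intro ge_one_powr_ge_zero) auto
  then have m1: "real (card F) \<ge> 1" using m by linarith
  have le: "real (card (disjoint_pairs F)) \<le> N"
    unfolding N_def using card_disjoint_pairs_le[OF fF] by (simp flip: of_nat_sum)
  show ?thesis
  proof (cases "N > 0")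
    case False
    then show ?thesis using le by (intro order_trans[OF le]) (simp add: order_trans[of _ 0])
  next
    case True
    have "2 \<le> 1 / \<delta>" using \<delta> by (simp add: field_simps)
    then have "log 2 2 \<le> s" unfolding s_def using \<delta> by (subst log_le_cancel_iff) auto
    then have s: "s \<ge> 1" by simp
    \<comment> \<open>Rounding up costs at most 1, so \<open>t + 1 \<le> 64 * s + 2\<close>, and
      \<open>s \<ge> 1\<close> absorbs the 2. This is the source of \<open>1/66\<close>.\<close>
    have t: "real t \<ge> 64 * s" "real t + 1 \<le> 66 * s"
      using s unfolding t_def by linarith+
    define l where "l = ln (real (card F))"
    have l0: "l \<ge> 0" using m1 by (simp add: l_def)
    have "ln (2 powr ((1/2 + \<delta>) * real (card X))) \<le> l"
      unfolding l_def using m m1 by (subst ln_le_cancel_iff) auto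
    then have l: "(1/2 + \<delta>) * (ln 2 * card X) \<le> l" by (simp add: mult_ac)
    \<comment> \<open>As \<open>\<delta> < 1/2\<close>, the size hypothesis bounds the term in
      \<open>card X\<close> by \<open>(2 - \<delta>) * l\<close>. This saves
      \<open>\<delta> * l\<close> against the trivial \<open>2 * (t + 1) * l\<close>.\<close>
    have "\<delta> * \<delta> \<le> \<delta> * (1/2)" using \<delta> by (intro mult_left_mono) auto
    moreover have "(2 - \<delta>) * (1/2 + \<delta>) = 1 + 3/2 * \<delta> - \<delta> * \<delta>"
      by (simp add: field_simps)
    ultimately have "1 + \<delta> \<le> (2 - \<delta>) * (1/2 + \<delta>)" using \<delta> by linarith
    then have "(1 + \<delta>) * (ln 2 * card X) \<le> (2 - \<delta>) * (1/2 + \<delta>) * (ln 2 * card X)"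
      by (intro mult_right_mono) auto
    also have "\<dots> \<le> (2 - \<delta>) * l"
      using l \<delta> unfolding mult.assoc by (intro mult_left_mono) auto
    finally have "(t + 1) * ln N \<le> (2 * (t + 1) - \<delta>) * l"
      using ln_sum_disj_nbrs_le[OF X F \<delta> t(1)[unfolded s_def] N_def True]
      by (simp add: l_def algebra_simps)
    then have "ln N \<le> (2 - \<delta> / (t + 1)) * l" by (simp add: field_simps)
    also have "\<dots> \<le> (2 - 1/66 * \<delta> / s) * l"
    proof (intro mult_right_mono l0)
      have "\<delta> / (66 * s) \<le> \<delta> / (t + 1)" using t(2) \<delta> by (intro divide_left_mono) auto
      then show "2 - \<delta> / (t + 1) \<le> 2 - 1/66 * \<delta> / s" by simp
    qed
    finally have "exp (ln N) \<le> exp ((2 - 1/66 * \<delta> / s) * l)" by (simp only: exp_le_cancel_iff)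
    then have "N \<le> real (card F) powr (2 - 1/66 * \<delta> / s)"
      using True m1 by (simp add: powr_def l_def)
    then show ?thesis using le by (simp add: s_def)
  qed
qed

theorem theorem1p2:
  "\<exists>c::real. c > 0 \<and>
     (\<forall>(n::nat) (\<delta>::real) (F::nat set set).
        n \<ge> 1 \<longrightarrow> 0 < \<delta> \<longrightarrow> \<delta> < 1/2 \<longrightarrow> F \<subseteq> Pow {1..n} \<longrightarrow>
        real (card F) \<ge> 2 powr ((1/2 + \<delta>) * real n) \<longrightarrow>
        real (card (disjoint_pairs F)) \<le> real (card F) powr (2 - c * \<delta> / log 2 (1/\<delta>)))"
proof (intro exI[of _ "1/66"] conjI allI impI)
  fix n :: nat and \<delta> :: real and F :: "nat set set"
  assume "0 < \<delta>" "\<delta> < 1/2" "F \<subseteq> Pow {1..n}" "real (card F) \<ge> 2 powr ((1/2 + \<delta>) * real n)"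
  then show "real (card (disjoint_pairs F)) \<le> real (card F) powr (2 - 1/66 * \<delta> / log 2 (1/\<delta>))"
    by (intro card_disjoint_pairs_le_powr[of "{1..n}"]) auto
qed simp

end
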